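(* For every integer $n\ge0$, let $B_n$ be the number of $n$-tilings using squares and $(1,1)$-fences, i.e. the number of tilings of boards (of any length) that use exactly $n$ tiles in total, each tile being a square or a $(1,1)$-fence. Then $B_n=J_{n+1}$, where $J_m$ is the $m$th Jacobsthal number.
   Context: A board of length $L$ is a $1\times L$ row of unit cells. A square is a $1\times1$ tile covering one cell. A $(1,1)$-fence is a tile made of two $1\times1$ posts separated by a one-cell gap; placed on a board its posts occupy cells $i$ and $i+2$, and the gap cell $i+1$ must be covered by another tile. A tiling covers every cell of the board exactly once. The empty tiling (using $0$ tiles, of the empty board) is counted, so $B_0=1$. Jacobsthal numbers: $J_0=0$, $J_1=1$, $J_m=J_{m-1}+2J_{m-2}$ for $m\ge2$. *)

theory Defs
  imports Main "HOL-Library.Disjoint_Sets"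
begin

text \<open>
  The cells of the board of length \<open>L\<close> are \<open>0, ..., L - 1\<close>. A tile is given together with
  its position: the cell of the square, respectively the cell of the left post of the fence.
\<close>

datatype tile = Square nat | Fence nat

fun cells :: "tile \<Rightarrow> nat set" where
  "cells (Square i) = {i}"
| "cells (Fence i) = {i, i + 2}"

text \<open>
  The gap cell \<open>i + 1\<close> of a fence on the board is itself a cell of the board, so it is
  covered by another tile.
\<close>

definition is_tiling :: "nat \<Rightarrow> tile set \<Rightarrow> bool" where
  "is_tiling L T \<longleftrightarrow> disjoint_family_on cells T \<and> (\<Union>t\<in>T. cells t) = {..<L}"

definition n_tilings :: "nat \<Rightarrow> (nat \<times> tile set) set" where
  "n_tilings n = {(L, T). is_tiling L T \<and> finite T \<and> card T = n}"

definition B :: "nat \<Rightarrow> nat" where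
  "B n = card (n_tilings n)"

fun jacobsthal :: "nat \<Rightarrow> nat" where
  "jacobsthal 0 = 0"
| "jacobsthal (Suc 0) = 1"
| "jacobsthal (Suc (Suc m)) = jacobsthal (Suc m) + 2 * jacobsthal m"

end

theory Submission
  imports Defs
begin

text \<open>
  Cell 0 of a nonempty tiled board is covered by a square or by the left post of a fence, and in
  the latter case cell 1 is covered by a square or by the left post of a second, interlocking
  fence. So every such tiling starts with exactly one of three blocks, which have 1, 2 and 2 tiles
  and fill an initial segment of the board; removing the block yields
  \<open>B (n + 2) = B (n + 1) + 2 * B n\<close>.
\<close>

section \<open>Translation of tiles along the board\<close>

fun shift :: "nat \<Rightarrow> tile \<Rightarrow> tile" where
  "shift p (Square i) = Square (p + i)"
| "shift p (Fence i) = Fence (p + i)"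

lemma inj_shift: "inj (shift p)"
proof (rule injI)
  show "s = t" if "shift p s = shift p t" for s t
    using that by (cases s; cases t) auto
qed

lemma cells_shift: "cells (shift p t) = (+) p ` cells t"
  by (cases t) auto

lemma cells_nonempty: "cells t \<noteq> {}"
  by (cases t) auto

text \<open>The position of \<open>t\<close> is one of its cells, hence at least \<open>p\<close>,
  so the truncated subtraction \<open>i - p\<close> loses nothing.\<close>

lemma shift_surj:
  assumes "cells t \<inter> {..<p} = {}"
  obtains s where "t = shift p s"
proof (cases t)
  case (Square i)
  then show ?thesis using assms that[of "Square (i - p)"] by auto
next
  case (Fence i)
  then show ?thesis using assms that[of "Fence (i - p)"] by auto
qed

section \<open>Prepending and removing an initial block\<close>

lemma is_tilingD_disjoint:
  assumes "is_tiling L T" "s \<in> T" "t \<in> T" "s \<noteq> t"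
  shows "cells s \<inter> cells t = {}"
  using assms by (auto simp: is_tiling_def disjoint_family_on_def)

lemma is_tilingD_cover: "is_tiling L T \<Longrightarrow> (\<Union>t\<in>T. cells t) = {..<L}"
  by (simp add: is_tiling_def)

text \<open>Tiles of \<open>P\<close> stay below cell \<open>p\<close>, while a shifted tile has at
  least one cell and none below \<open>p\<close>. This makes tile counts add and lets
  \<open>T\<close> be recovered from the union.\<close>

lemma block_Int_shift:
  assumes "is_tiling p P"
  shows "P \<inter> shift p ` T = {}"
proof -
  have False if "shift p t \<in> P" for t
  proof -
    have "(+) p ` cells t \<subseteq> {..<p}"
      using is_tilingD_cover[OF assms] that by (auto simp: cells_shift[symmetric])
    then show False using cells_nonempty[of t] by auto
  qed
  then show ?thesis by auto
qed

lemma is_tiling_append: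
  assumes P: "is_tiling p P" and T: "is_tiling L T"
  shows "is_tiling (p + L) (P \<union> shift p ` T)"
proof -
  have P_cells: "cells s \<subseteq> {..<p}" if "s \<in> P" for s
    using is_tilingD_cover[OF P] that by auto
  have PT: "cells s \<inter> (+) p ` cells t = {}" if "s \<in> P" for s t
    using P_cells[OF that] by auto
  have "disjoint_family_on cells (P \<union> shift p ` T)"
    unfolding disjoint_family_on_def
  proof (intro ballI impI)
    fix s t assume "s \<in> P \<union> shift p ` T" "t \<in> P \<union> shift p ` T" and "s \<noteq> t"
    then consider "s \<in> P" "t \<in> P" | t' where "s \<in> P" "t = shift p t'"
      | s' where "s = shift p s'" "t \<in> P"
      | s' t' where "s = shift p s'" "t = shift p t'" "s' \<in> T" "t' \<in> T"
      by blast
    then show "cells s \<inter> cells t = {}"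
    proof cases
      case 1
      then show ?thesis using is_tilingD_disjoint[OF P] \<open>s \<noteq> t\<close> by blast
    next
      case 2
      then show ?thesis using PT by (simp add: cells_shift)
    next
      case 3
      then show ?thesis using PT by (simp add: cells_shift Int_commute)
    next
      case 4
      then have "cells s' \<inter> cells t' = {}"
        using is_tilingD_disjoint[OF T] \<open>s \<noteq> t\<close> by blast
      then show ?thesis using 4 by (auto simp: cells_shift)
    qed
  qed
  moreover have "(\<Union>t\<in>P \<union> shift p ` T. cells t) = {..<p + L}"
  proof -
    have "(\<Union>t\<in>P \<union> shift p ` T. cells t) = {..<p} \<union> (+) p ` {..<L}"
      by (simp add: UN_Un cells_shift image_UN[symmetric] is_tilingD_cover[OF P]
          is_tilingD_cover[OF T])
    also have "\<dots> = {..<p + L}"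
      by (auto simp: lessThan_atLeast0 image_add_atLeastLessThan)
    finally show ?thesis .
  qed
  ultimately show ?thesis by (simp add: is_tiling_def)
qed

text \<open>Since \<open>P\<close> fills the first \<open>p\<close> cells completely, no other tile
  of \<open>U\<close> has a post there, so all of them can be moved back by
  \<open>p\<close>.\<close>

lemma is_tiling_remove_block:
  assumes P: "is_tiling p P" and U: "is_tiling M U" and sub: "P \<subseteq> U"
  obtains L T where "M = p + L" "U = P \<union> shift p ` T" "is_tiling L T"
proof
  define T where "T = shift p -` (U - P)"
  have "{..<p} \<subseteq> {..<M}"
    unfolding is_tilingD_cover[OF P, symmetric] is_tilingD_cover[OF U, symmetric]
    using sub by blast
  then have "p \<le> M" by simp
  then show "M = p + (M - p)" by simp
  have rest: "cells t \<inter> {..<p} = {}" if "t \<in> U - P" for t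
  proof -
    have "cells t \<inter> cells s = {}" if "s \<in> P" for s
      using is_tilingD_disjoint[OF U] \<open>t \<in> U - P\<close> that sub by blast
    then show ?thesis unfolding is_tilingD_cover[OF P, symmetric] by blast
  qed
  have image: "shift p ` T = U - P"
  proof
    show "U - P \<subseteq> shift p ` T"
    proof
      fix t assume "t \<in> U - P"
      moreover from this obtain s where "t = shift p s" using rest shift_surj by meson
      ultimately show "t \<in> shift p ` T" by (simp add: T_def)
    qed
  qed (auto simp: T_def)
  then show "U = P \<union> shift p ` T" using sub by blast
  have "disjoint_family_on cells T"
    unfolding disjoint_family_on_def
  proof (intro ballI impI)
    fix s t assume "s \<in> T" "t \<in> T" "s \<noteq> t"
    then have "cells (shift p s) \<inter> cells (shift p t) = {}"
      by (intro is_tilingD_disjoint[OF U]) (auto simp: T_def inj_eq[OF inj_shift])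
    then show "cells s \<inter> cells t = {}" by (auto simp: cells_shift)
  qed
  moreover have "(\<Union>t\<in>T. cells t) = {..<M - p}"
  proof -
    \<comment> \<open>The cover is computed in the coordinates of the long board; injectivity of the
      translation then cancels \<open>p\<close>.\<close>
    have "(+) p ` (\<Union>t\<in>T. cells t) = (\<Union>t\<in>U - P. cells t)"
      by (simp add: image[symmetric] cells_shift image_UN)
    also have "\<dots> = (\<Union>t\<in>U. cells t) - (\<Union>t\<in>P. cells t)"
      using rest unfolding is_tilingD_cover[OF P, symmetric] by blast
    also have "\<dots> = {p..<M}"
      by (auto simp: is_tilingD_cover[OF P] is_tilingD_cover[OF U])
    also have "\<dots> = (+) p ` {..<M - p}"
      using \<open>p \<le> M\<close> by (simp add: lessThan_atLeast0 image_add_atLeastLessThan)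
    finally show ?thesis by (simp add: inj_image_eq_iff)
  qed
  ultimately show "is_tiling (M - p) T" by (simp add: is_tiling_def)
qed

text \<open>Tiles carry their positions, so for a block \<open>P\<close> that tiles an initial
  segment, inclusion already means that the tiling starts with \<open>P\<close>.\<close>

definition n_tilings_with :: "tile set \<Rightarrow> nat \<Rightarrow> (nat \<times> tile set) set" where
  "n_tilings_with P n = {(L, T) \<in> n_tilings n. P \<subseteq> T}"

text \<open>Prepending \<open>P\<close> is undone by removing it. The board grows by
  \<open>p\<close> but the tile count by \<open>card P\<close>, and only the latter enters the
  recurrence.\<close>

lemma bij_betw_n_tilings_with:
  assumes P: "is_tiling p P" and "finite P"
  shows "bij_betw (\<lambda>(L, T). (p + L, P \<union> shift p ` T)) (n_tilings n)
           (n_tilings_with P (card P + n))" (is "bij_betw ?f _ _")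
proof (rule bij_betw_imageI)
  show "inj_on ?f (n_tilings n)"
  proof (rule inj_onI, clarsimp)
    fix T T' assume "P \<union> shift p ` T = P \<union> shift p ` T'"
    then have "shift p ` T = shift p ` T'"
      using block_Int_shift[OF P] by blast
    then show "T = T'" by (simp add: inj_image_eq_iff inj_shift)
  qed
  have card: "card (P \<union> shift p ` T) = card P + card T" if "finite T" for T
    using that assms block_Int_shift[OF P]
    by (simp add: card_Un_disjoint card_image inj_on_subset[OF inj_shift])
  show "?f ` n_tilings n = n_tilings_with P (card P + n)"
  proof (intro equalityI subsetI)
    fix x assume "x \<in> ?f ` n_tilings n"
    then show "x \<in> n_tilings_with P (card P + n)"
      using assms by (auto simp: n_tilings_with_def n_tilings_def card intro: is_tiling_append)
  next
    fix x assume "x \<in> n_tilings_with P (card P + n)"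
    then obtain M U where x: "x = (M, U)" and U: "is_tiling M U" "P \<subseteq> U" "finite U"
      "card U = card P + n"
      by (auto simp: n_tilings_with_def n_tilings_def)
    obtain L T where LT: "M = p + L" "U = P \<union> shift p ` T" "is_tiling L T"
      using is_tiling_remove_block[OF P U(1,2)] .
    have "finite T"
      using U(3) LT(2) by (auto dest: finite_imageD intro: inj_on_subset[OF inj_shift])
    then have "(L, T) \<in> n_tilings n"
      using LT U(4) card by (simp add: n_tilings_def)
    then show "x \<in> ?f ` n_tilings n"
      using x LT by (auto intro!: rev_image_eqI)
  qed
qed

section \<open>The three starting blocks\<close>

lemma is_tiling_starting_block:
  "is_tiling 1 {Square 0}"
  "is_tiling 3 {Fence 0, Square 1}"
  "is_tiling 4 {Fence 0, Fence 1}"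
  by (auto simp: is_tiling_def disjoint_family_on_def)

lemma n_tilings_Suc_eq:
  "n_tilings (Suc n) = n_tilings_with {Square 0} (Suc n)
     \<union> n_tilings_with {Fence 0, Square 1} (Suc n) \<union> n_tilings_with {Fence 0, Fence 1} (Suc n)"
proof (intro equalityI subsetI)
  fix x assume x_in: "x \<in> n_tilings (Suc n)"
  then obtain L T where x: "x = (L, T)" and T: "is_tiling L T" "card T = Suc n"
    by (auto simp: n_tilings_def)
  note cover = is_tilingD_cover[OF T(1)]
  obtain t where "t \<in> T" using T(2) by fastforce
  then have "L > 0" using cover cells_nonempty[of t] by (cases L) auto
  then obtain s where s: "s \<in> T" "0 \<in> cells s" using cover by blast
  have "{Square 0} \<subseteq> T \<or> {Fence 0, Square 1} \<subseteq> T \<or> {Fence 0, Fence 1} \<subseteq> T"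
  proof (cases s)
    case (Square i)
    then show ?thesis using s by simp
  next
    case (Fence i)
    \<comment> \<open>A right post lies at cell 2 or later, so cell 0 can only hold a left
      post.\<close>
    then have F: "Fence 0 \<in> T" using s by simp
    \<comment> \<open>The right post of \<open>Fence 0\<close> is on the board, hence so is its gap
      cell 1, which needs a tile of its own.\<close>
    then have "2 < L" using cover by force
    then have "1 \<in> {..<L}" by simp
    then obtain r where r: "r \<in> T" "1 \<in> cells r" using cover by blast
    then have "r = Square 1 \<or> r = Fence 1" by (cases r) auto
    then show ?thesis using r F by auto
  qed
  then show "x \<in> n_tilings_with {Square 0} (Suc n)
     \<union> n_tilings_with {Fence 0, Square 1} (Suc n) \<union> n_tilings_with {Fence 0, Fence 1} (Suc n)"
    using x x_in by (auto simp: n_tilings_with_def)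
qed (auto simp: n_tilings_with_def)

text \<open>No tiling can contain two distinct overlapping tiles; this separates the three cases of
  the decomposition.\<close>

lemma n_tilings_with_disjoint:
  assumes "s \<in> P" "t \<in> Q" "s \<noteq> t" "cells s \<inter> cells t \<noteq> {}"
  shows "n_tilings_with P n \<inter> n_tilings_with Q n = {}"
  using assms by (auto simp: n_tilings_with_def n_tilings_def dest: is_tilingD_disjoint)

section \<open>Base cases and the recurrence\<close>

lemma n_tilings_0: "n_tilings 0 = {(0, {})}"
  by (auto simp: n_tilings_def is_tiling_def disjoint_family_on_def)

lemma n_tilings_with_empty:
  assumes "n < card P"
  shows "n_tilings_with P n = {}"
  using assms by (auto simp: n_tilings_with_def n_tilings_def dest: card_mono)

lemma finite_n_tilings_with_iff:
  assumes "is_tiling p P" "finite P"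
  shows "finite (n_tilings_with P (card P + n)) \<longleftrightarrow> finite (n_tilings n)"
  using bij_betw_finite[OF bij_betw_n_tilings_with[OF assms]] by simp

lemma card_n_tilings_with:
  assumes "is_tiling p P" "finite P"
  shows "card (n_tilings_with P (card P + n)) = B n"
  using bij_betw_same_card[OF bij_betw_n_tilings_with[OF assms]] by (simp add: B_def)

text \<open>Finiteness is proved alongside the count because adding cardinalities of disjoint sets
  requires it. The recursion of \<open>jacobsthal\<close> supplies both predecessors
  \<open>n\<close> and \<open>Suc n\<close>.\<close>

lemma finite_n_tilings: "finite (n_tilings n)"
  and B_eq_jacobsthal: "B n = jacobsthal (Suc n)"
proof (induction n rule: jacobsthal.induct)
  case 1
  show "finite (n_tilings 0)" "B 0 = jacobsthal (Suc 0)"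
    by (simp_all add: n_tilings_0 B_def)
next
  case 2
  \<comment> \<open>A single tile leaves no room for the two blocks of two tiles.\<close>
  have "n_tilings (Suc 0) = n_tilings_with {Square 0} (Suc 0)"
    using n_tilings_Suc_eq[of 0] by (simp add: n_tilings_with_empty)
  then show "finite (n_tilings (Suc 0))" "B (Suc 0) = jacobsthal (Suc (Suc 0))"
    using finite_n_tilings_with_iff[OF is_tiling_starting_block(1), of 0]
      card_n_tilings_with[OF is_tiling_starting_block(1), of 0]
    by (simp_all add: n_tilings_0 B_def)
next
  case (3 n)
  let ?S = "n_tilings_with {Square 0} (Suc (Suc n))"
  let ?FS = "n_tilings_with {Fence 0, Square 1} (Suc (Suc n))"
  let ?FF = "n_tilings_with {Fence 0, Fence 1} (Suc (Suc n))"
  have finite: "finite ?S" "finite ?FS" "finite ?FF"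
    using 3 finite_n_tilings_with_iff[OF is_tiling_starting_block(1), of "Suc n"]
      finite_n_tilings_with_iff[OF is_tiling_starting_block(2), of n]
      finite_n_tilings_with_iff[OF is_tiling_starting_block(3), of n]
    by simp_all
  have card: "card ?S = B (Suc n)" "card ?FS = B n" "card ?FF = B n"
    using card_n_tilings_with[OF is_tiling_starting_block(1), of "Suc n"]
      card_n_tilings_with[OF is_tiling_starting_block(2), of n]
      card_n_tilings_with[OF is_tiling_starting_block(3), of n]
    by simp_all
  have disjoint: "?S \<inter> ?FS = {}" "?S \<inter> ?FF = {}" "?FS \<inter> ?FF = {}"
    \<comment> \<open>The first block clashes with the other two at cell 0; these two clash with
      each other at cell 1.\<close>
    using n_tilings_with_disjoint[of "Square 0" _ "Fence 0"]
      n_tilings_with_disjoint[of "Square 1" _ "Fence 1"]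
    by simp_all
  note union = n_tilings_Suc_eq[of "Suc n"]
  show "finite (n_tilings (Suc (Suc n)))"
    using finite by (simp add: union)
  have "B (Suc (Suc n)) = card ?S + card ?FS + card ?FF"
    unfolding B_def union using finite disjoint by (simp add: card_Un_disjoint Int_Un_distrib2)
  then show "B (Suc (Suc n)) = jacobsthal (Suc (Suc (Suc n)))"
    using 3 card by simp
qed

theorem theorem2p5:
  fixes n :: nat
  shows "B n = jacobsthal (n + 1)"
  by (simp add: B_eq_jacobsthal)

end
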